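(* For all integers $p\ge0$ and $n\ge2$, \[ \mathrm{Bel}_{n+1,\lambda}^{(p)}=(n+1-n\lambda)\mathrm{Bel}_{n,\lambda}^{(p)}-\frac{p}{p+1}\mathrm{Bel}_{n,\lambda}^{(p+1)}-\sum_{m=0}^{n-2}\binom{n}{m}\mathrm{Bel}_{m+1,\lambda}^{(p)}(\lambda-1)_{n-m,\lambda}. \] In particular (case $p=0$), \[ \mathrm{Bel}_{n+1,\lambda}=(n+1-n\lambda)\mathrm{Bel}_{n,\lambda}-\sum_{m=0}^{n-2}\binom{n}{m}\mathrm{Bel}_{m+1,\lambda}(\lambda-1)_{n-m,\lambda}=(n+1-n\lambda)\mathrm{Bel}_{n,\lambda}-\sum_{m=0}^{n-1}\binom{n}{m-1}\mathrm{Bel}_{m,\lambda}(\lambda-1)_{n-m+1,\lambda}, \] with the convention $\binom{n}{-1}=0$.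
   Context: Let $\lambda\in\mathbb{R}$. Set $(x)_{0,\lambda}=1$, $(x)_{n,\lambda}=x(x-\lambda)\cdots(x-(n-1)\lambda)$ for $n\ge1$. The degenerate exponential is the formal power series $e_\lambda^x(t)=\sum_{n\ge0}(x)_{n,\lambda}\frac{t^n}{n!}$ ($=(1+\lambda t)^{x/\lambda}$, and $e^{xt}$ if $\lambda=0$), $e_\lambda(t)=e_\lambda^1(t)$. Degenerate Bell numbers: $e^{e_\lambda(t)-1}=\sum_{n\ge0}\mathrm{Bel}_{n,\lambda}\frac{t^n}{n!}$. For an integer $p\ge0$, the truncated degenerate Bell numbers $\mathrm{Bel}^{(p)}_{n,\lambda}$ are defined by $\sum_{n\ge0}\mathrm{Bel}^{(p)}_{n,\lambda}\frac{t^n}{n!}=\frac{p!}{(e_\lambda(t)-1)^p}\Big(e^{e_\lambda(t)-1}-\sum_{k=0}^{p-1}\frac{(e_\lambda(t)-1)^k}{k!}\Big)=p!\sum_{k\ge0}\frac{(e_\lambda(t)-1)^k}{(k+p)!}$; note $\mathrm{Bel}^{(0)}_{n,\lambda}=\mathrm{Bel}_{n,\lambda}$. *)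

theory Defs
  imports Complex_Main "HOL-Computational_Algebra.Formal_Power_Series"
begin

definition deg_falling :: "real \<Rightarrow> real \<Rightarrow> nat \<Rightarrow> real" where
  "deg_falling lam x n = (\<Prod>i<n. x - real i * lam)"

definition deg_exp :: "real \<Rightarrow> real \<Rightarrow> real fps" where
  "deg_exp lam x = Abs_fps (\<lambda>n. deg_falling lam x n / fact n)"

(* Bel_n is n! times the coefficient of t^n in exp(e_lam(t) - 1).  The composition is
   legitimate because e_lam(t) - 1 has zero constant term. *)
definition deg_Bell :: "real \<Rightarrow> nat \<Rightarrow> real" where
  "deg_Bell lam n = fact n * fps_nth (fps_exp 1 oo (deg_exp lam 1 - 1)) n"

(* p! / u^p * (exp u - (\<Sum>k<p. u^k / k!)) with u = e_lam(t) - 1.  As p! / u^p is not itself a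
   power series for p > 0, the quotient is taken last; it is exact, because u^p divides the
   numerator (see trunc_deg_Bell_gf_eq). *)
definition trunc_deg_Bell_gf :: "real \<Rightarrow> nat \<Rightarrow> real fps" where
  "trunc_deg_Bell_gf lam p =
     (let u = deg_exp lam 1 - 1
      in fps_const (fact p) * ((fps_exp 1 oo u) - (\<Sum>k<p. fps_const (1 / fact k) * u ^ k)) / u ^ p)"

definition trunc_deg_Bell :: "real \<Rightarrow> nat \<Rightarrow> nat \<Rightarrow> real" where
  "trunc_deg_Bell lam p n = fact n * fps_nth (trunc_deg_Bell_gf lam p) n"

(* n choose k for an integer lower index, with value 0 for negative k. *)
definition choose_int :: "nat \<Rightarrow> int \<Rightarrow> nat" where
  "choose_int n k = (if k < 0 then 0 else n choose nat k)"

lemma deg_exp_zero: "deg_exp 0 x = fps_exp x"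
  by (simp add: fps_eq_iff deg_exp_def deg_falling_def)

lemma deg_exp_minus_one_nth:
  "fps_nth (deg_exp lam 1 - 1) 0 = 0" "fps_nth (deg_exp lam 1 - 1) 1 = 1"
  by (simp_all add: deg_exp_def deg_falling_def)

lemma trunc_deg_Bell_gf_eq:
  "trunc_deg_Bell_gf lam p =
     fps_const (fact p) * (Abs_fps (\<lambda>k. 1 / fact (k + p)) oo (deg_exp lam 1 - 1))"
proof -
  define u where "u = deg_exp lam 1 - 1"
  define G :: "real fps" where "G = Abs_fps (\<lambda>k. 1 / fact (k + p))"
  have u0: "fps_nth u 0 = 0" and u1: "fps_nth u 1 = 1"
    unfolding u_def by (rule deg_exp_minus_one_nth)+
  have un: "u ^ p \<noteq> 0" using u1 by auto
  have "fps_exp (1::real) = fps_X ^ p * G + (\<Sum>k<p. fps_const (1 / fact k) * fps_X ^ k)"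
    by (auto simp: fps_eq_iff G_def fps_X_power_mult_nth fps_sum_nth fps_X_power_nth
        if_distrib[of "\<lambda>x. _ * x"] sum.delta cong: if_cong)
  then have "fps_exp 1 oo u = u ^ p * (G oo u) + (\<Sum>k<p. fps_const (1 / fact k) * u ^ k)"
    using u0 by (simp add: fps_compose_add_distrib fps_compose_sum_distrib
        fps_compose_mult_distrib fps_compose_power[symmetric])
  then have "trunc_deg_Bell_gf lam p = (u ^ p * (fps_const (fact p) * (G oo u))) / u ^ p"
    by (simp add: trunc_deg_Bell_gf_def Let_def u_def[symmetric] mult_ac)
  also have "\<dots> = fps_const (fact p) * (G oo u)"
    using un by (rule nonzero_mult_div_cancel_left)
  finally show ?thesis by (simp add: G_def u_def)
qed

lemma trunc_deg_Bell_0: "trunc_deg_Bell lam 0 n = deg_Bell lam n"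
  by (simp add: trunc_deg_Bell_def deg_Bell_def trunc_deg_Bell_gf_def Let_def)

end

theory Submission
  imports Defs
begin

text \<open>Write \<open>u = e\<^sub>\<lambda>(t) - 1\<close> and let \<open>F\<^sub>p\<close> be the generating function of the truncated degenerate
  Bell numbers. Splitting \<open>k / (k + p)! = 1 / (k + p - 1)! - p / (k + p)!\<close> gives
  \<open>F\<^sub>p' = u' (F\<^sub>p - p / (p + 1) F\<^sub>p\<^sub>+\<^sub>1)\<close>. As \<open>u'\<close> is \<open>e\<^sub>\<lambda>(t)\<close> to the power \<open>1 - \<lambda>\<close>, multiplication
  with the power \<open>\<lambda> - 1\<close> isolates the bracket, and the recurrence is the coefficient of \<open>t\<^sup>n\<close>,
  with the two terms \<open>m = n\<close> and \<open>m = n - 1\<close> of the binomial convolution split off.\<close>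

lemma deg_falling_0 [simp]: "deg_falling lam x 0 = 1"
  by (simp add: deg_falling_def)

lemma deg_falling_Suc: "deg_falling lam x (Suc n) = deg_falling lam x n * (x - real n * lam)"
  by (simp add: deg_falling_def)

text \<open>Peeling off the first factor, rather than the last, shifts the base point. This is what
  makes the derivative of \<open>deg_exp lam x\<close> a multiple of
  \<open>deg_exp lam (x - lam)\<close>.\<close>

lemma deg_falling_Suc_shift: "deg_falling lam x (Suc n) = x * deg_falling lam (x - lam) n"
  by (simp add: deg_falling_def prod.lessThan_Suc_shift algebra_simps del: prod.lessThan_Suc)

lemma deg_exp_nth_0 [simp]: "fps_nth (deg_exp lam x) 0 = 1"
  by (simp add: deg_exp_def)

lemma deg_exp_0_right [simp]: "deg_exp lam 0 = 1"
proof (rule fps_ext)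
  fix n
  show "fps_nth (deg_exp lam 0) n = fps_nth 1 n"
    by (cases n) (simp_all add: deg_exp_def deg_falling_Suc_shift)
qed

lemma fps_deriv_deg_exp: "fps_deriv (deg_exp lam x) = fps_const x * deg_exp lam (x - lam)"
  by (simp add: fps_eq_iff deg_exp_def deg_falling_Suc_shift field_simps del: of_nat_Suc)

lemma fps_nth_one_plus_X_mult_deriv:
  "fps_nth ((1 + fps_const c * fps_X) * fps_deriv F) n =
     of_nat (Suc n) * fps_nth F (Suc n) + of_nat n * c * fps_nth F n"
  for F :: "'a :: comm_ring_1 fps"
  by (cases n) (simp_all add: distrib_right mult.assoc algebra_simps)

text \<open>Peeling off the last factor gives a two-term recurrence of the coefficients. This is the
  differential equation of \<open>(1 + lam * t)\<close> to the power \<open>x / lam\<close>, in a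
  form that never divides by \<open>lam\<close>.\<close>

lemma deg_exp_ode: "(1 + fps_const lam * fps_X) * fps_deriv (deg_exp lam x) = fps_const x * deg_exp lam x"
proof (rule fps_ext)
  fix n
  have "real (Suc n) * fps_nth (deg_exp lam x) (Suc n) = (x - real n * lam) * fps_nth (deg_exp lam x) n"
    by (simp add: deg_exp_def deg_falling_Suc fact_Suc mult_ac del: of_nat_Suc)
  then show "fps_nth ((1 + fps_const lam * fps_X) * fps_deriv (deg_exp lam x)) n =
      fps_nth (fps_const x * deg_exp lam x) n"
    unfolding fps_nth_one_plus_X_mult_deriv by (simp add: algebra_simps)
qed

text \<open>The coefficient of \<open>t^n\<close> in the equation determines coefficient
  \<open>n + 1\<close> from coefficient \<open>n\<close>, since \<open>Suc n\<close> is invertible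
  in the reals.\<close>

lemma deg_exp_unique:
  assumes ode: "(1 + fps_const lam * fps_X) * fps_deriv F = fps_const x * F"
    and F0: "fps_nth F 0 = 1"
  shows "F = deg_exp lam x"
proof (rule fps_ext)
  fix n
  show "fps_nth F n = fps_nth (deg_exp lam x) n"
  proof (induction n)
    case 0
    show ?case by (simp add: F0)
  next
    case (Suc n)
    have rec: "real (Suc n) * fps_nth G (Suc n) = (x - real n * lam) * fps_nth G n"
      if "(1 + fps_const lam * fps_X) * fps_deriv G = fps_const x * G" for G
      using arg_cong[OF that, of "\<lambda>H. fps_nth H n"]
      unfolding fps_nth_one_plus_X_mult_deriv by (simp add: algebra_simps)
    from rec[OF ode] rec[OF deg_exp_ode] Suc.IH
    have "real (Suc n) * fps_nth F (Suc n) = real (Suc n) * fps_nth (deg_exp lam x) (Suc n)"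
      by simp
    then show ?case by simp
  qed
qed

text \<open>By the product rule, the left side solves the equation that characterises the right
  side.\<close>

lemma deg_exp_add: "deg_exp lam x * deg_exp lam y = deg_exp lam (x + y)"
proof (rule deg_exp_unique)
  let ?E = "deg_exp lam" and ?c = "1 + fps_const lam * fps_X"
  have "?c * fps_deriv (?E x * ?E y) =
      (?c * fps_deriv (?E x)) * ?E y + ?E x * (?c * fps_deriv (?E y))"
    by (simp add: algebra_simps)
  also have "\<dots> = fps_const (x + y) * (?E x * ?E y)"
    unfolding deg_exp_ode by (simp add: algebra_simps flip: fps_const_add)
  finally show "?c * fps_deriv (?E x * ?E y) = fps_const (x + y) * (?E x * ?E y)" .
qed simp

lemma fps_deriv_exp_tail:
  fixes p :: nat
  defines "G \<equiv> \<lambda>q. Abs_fps (\<lambda>k. 1 / fact (k + q)) :: real fps"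
  shows "fps_deriv (G p) = G p - fps_const (real p) * G (p + 1)"
proof (rule fps_ext)
  fix n
  \<comment> \<open>The splitting for \<open>k = n + 1\<close>: write \<open>n + 1\<close> as
    \<open>(n + p + 1) - p\<close>.\<close>
  have "real (n + 1) / fact (Suc (n + p)) = 1 / fact (n + p) - real p / fact (Suc (n + p))"
    by (simp add: divide_simps)
  then show "fps_nth (fps_deriv (G p)) n = fps_nth (G p - fps_const (real p) * G (p + 1)) n"
    by (simp add: G_def)
qed

lemma fps_deriv_trunc_deg_Bell_gf:
  "fps_deriv (trunc_deg_Bell_gf lam p) = deg_exp lam (1 - lam) *
     (trunc_deg_Bell_gf lam p - fps_const (real p / (real p + 1)) * trunc_deg_Bell_gf lam (p + 1))"
proof -
  define u where "u = deg_exp lam 1 - 1"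
  define G :: "nat \<Rightarrow> real fps" where "G q = Abs_fps (\<lambda>k. 1 / fact (k + q))" for q
  have gf: "trunc_deg_Bell_gf lam q = fps_const (fact q) * (G q oo u)" for q
    by (simp add: trunc_deg_Bell_gf_eq G_def u_def)
  have u0: "fps_nth u 0 = 0"
    by (simp add: u_def)
  have u': "fps_deriv u = deg_exp lam (1 - lam)"
    by (simp add: u_def fps_deriv_deg_exp)
  have "fps_deriv (G p oo u) = ((G p - fps_const (real p) * G (p + 1)) oo u) * deg_exp lam (1 - lam)"
    using fps_deriv_exp_tail[of p] u0 by (simp add: fps_compose_deriv u' G_def)
  also have "\<dots> = deg_exp lam (1 - lam) * ((G p oo u) - fps_const (real p) * (G (p + 1) oo u))"
    using u0 by (simp add: fps_compose_sub_distrib fps_compose_mult_distrib mult.commute)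
  finally have *: "fps_deriv (G p oo u) = \<dots>" .
  \<comment> \<open>The factor \<open>p / (p + 1)\<close> arises because the series for
    \<open>p + 1\<close> is normalised by \<open>(p + 1)!\<close>, while here only \<open>p!\<close>
    is present.\<close>
  have c: "fps_const (real p / (real p + 1)) * (fps_const (fact (p + 1)) * H)
      = fps_const (fact p) * (fps_const (real p) * H)" for H :: "real fps"
  proof -
    have "real p / (real p + 1) * fact (p + 1) = fact p * real p"
      by (simp add: field_simps)
    then show ?thesis
      by (simp only: mult.assoc[symmetric] fps_const_mult)
  qed
  show ?thesis
    unfolding gf c by (simp add: * algebra_simps)
qed

lemma trunc_deg_Bell_convolution:
  "(\<Sum>m\<le>n. real (n choose m) * trunc_deg_Bell lam p (m + 1) * deg_falling lam (lam - 1) (n - m)) =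
     trunc_deg_Bell lam p n - real p / (real p + 1) * trunc_deg_Bell lam (p + 1) n"
proof -
  let ?F = "trunc_deg_Bell_gf lam"
  have "fps_deriv (?F p) * deg_exp lam (lam - 1) =
      (deg_exp lam (1 - lam) * deg_exp lam (lam - 1)) *
      (?F p - fps_const (real p / (real p + 1)) * ?F (p + 1))"
    by (simp add: fps_deriv_trunc_deg_Bell_gf mult_ac)
  also have "\<dots> = ?F p - fps_const (real p / (real p + 1)) * ?F (p + 1)"
    by (simp add: deg_exp_add)
  finally have "fact n * fps_nth (fps_deriv (?F p) * deg_exp lam (lam - 1)) n =
      fact n * fps_nth (?F p - fps_const (real p / (real p + 1)) * ?F (p + 1)) n"
    by simp
  \<comment> \<open>The factor \<open>m + 1\<close> from the derivative turns \<open>m!\<close> into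
    the \<open>(m + 1)!\<close> that normalises \<open>trunc_deg_Bell lam p (m + 1)\<close>.\<close>
  moreover have "fact n * fps_nth (fps_deriv (?F p) * deg_exp lam (lam - 1)) n =
      (\<Sum>m\<le>n. real (n choose m) * trunc_deg_Bell lam p (m + 1) * deg_falling lam (lam - 1) (n - m))"
    unfolding fps_mult_nth sum_distrib_left atLeast0AtMost
    by (intro sum.cong refl)
      (simp add: trunc_deg_Bell_def deg_exp_def binomial_fact field_simps)
  ultimately show ?thesis
    by (simp add: trunc_deg_Bell_def right_diff_distrib mult_ac)
qed

lemma trunc_deg_Bell_rec:
  assumes "n \<ge> 2"
  shows "trunc_deg_Bell lam p (n + 1) =
         (real n + 1 - real n * lam) * trunc_deg_Bell lam p n
         - real p / (real p + 1) * trunc_deg_Bell lam (p + 1) n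
         - (\<Sum>m = 0..n - 2. real (n choose m) * trunc_deg_Bell lam p (m + 1)
              * deg_falling lam (lam - 1) (n - m))"
proof -
  obtain k where n: "n = Suc (Suc k)"
    using assms by (metis Suc_le_D numeral_2_eq_2 Suc_le_mono)
  let ?f = "\<lambda>m. real (n choose m) * trunc_deg_Bell lam p (m + 1) * deg_falling lam (lam - 1) (n - m)"
  have "(\<Sum>m\<le>n. ?f m) = (\<Sum>m = 0..n - 2. ?f m) + ?f (n - 1) + ?f n"
    by (simp add: n atLeast0AtMost)
  \<comment> \<open>Moved to the other side, this term contributes \<open>n - n * lam\<close> to the
    coefficient of \<open>trunc_deg_Bell lam p n\<close>.\<close>
  moreover have "?f (n - 1) = real n * (lam - 1) * trunc_deg_Bell lam p n"
    by (simp add: n deg_falling_Suc)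
  moreover have "?f n = trunc_deg_Bell lam p (n + 1)"
    by simp
  ultimately show ?thesis
    using trunc_deg_Bell_convolution[of n lam p] by (simp add: algebra_simps)
qed

text \<open>Substitute \<open>m + 1\<close> for \<open>m\<close> on the right; the extra term at
  \<open>m = 0\<close> vanishes by the convention for a negative lower index.\<close>

lemma sum_choose_int_shift:
  fixes f g :: "nat \<Rightarrow> real"
  assumes "n \<ge> 2"
  shows "(\<Sum>m = 0..n - 2. real (n choose m) * f (m + 1) * g (n - m)) =
         (\<Sum>m = 0..n - 1. real (choose_int n (int m - 1)) * f m * g (n - m + 1))"
proof -
  obtain k where n: "n = Suc (Suc k)"
    using assms by (metis Suc_le_D numeral_2_eq_2 Suc_le_mono)
  let ?h = "\<lambda>m. real (choose_int n (int m - 1)) * f m * g (n - m + 1)"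
  have "(\<Sum>m = 0..n - 1. ?h m) = ?h 0 + (\<Sum>m = 0..n - 2. ?h (Suc m))"
    by (simp add: n sum.atLeast0_atMost_Suc_shift del: sum.cl_ivl_Suc)
  also have "\<dots> = (\<Sum>m = 0..n - 2. real (n choose m) * f (m + 1) * g (n - m))"
    using assms by (auto simp: choose_int_def Suc_diff_Suc intro!: sum.cong)
  finally show ?thesis ..
qed

theorem theorem12:
  fixes lam :: real
  shows
    "(\<forall>p n::nat. n \<ge> 2 \<longrightarrow>
       trunc_deg_Bell lam p (n + 1) =
         (real n + 1 - real n * lam) * trunc_deg_Bell lam p n
         - real p / (real p + 1) * trunc_deg_Bell lam (p + 1) n
         - (\<Sum>m = 0..n - 2. real (n choose m) * trunc_deg_Bell lam p (m + 1)
              * deg_falling lam (lam - 1) (n - m)))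
   \<and>
     (\<forall>n::nat. n \<ge> 2 \<longrightarrow>
       deg_Bell lam (n + 1) =
         (real n + 1 - real n * lam) * deg_Bell lam n
         - (\<Sum>m = 0..n - 2. real (n choose m) * deg_Bell lam (m + 1)
              * deg_falling lam (lam - 1) (n - m))
     \<and> (real n + 1 - real n * lam) * deg_Bell lam n
         - (\<Sum>m = 0..n - 2. real (n choose m) * deg_Bell lam (m + 1)
              * deg_falling lam (lam - 1) (n - m)) =
         (real n + 1 - real n * lam) * deg_Bell lam n
         - (\<Sum>m = 0..n - 1. real (choose_int n (int m - 1)) * deg_Bell lam m
              * deg_falling lam (lam - 1) (n - m + 1)))"
  \<comment> \<open>At \<open>p = 0\<close> the factor \<open>p / (p + 1)\<close> is zero, so the
    term of order \<open>p + 1\<close> drops out.\<close>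
  using trunc_deg_Bell_rec[of _ lam] trunc_deg_Bell_rec[of _ lam 0, unfolded trunc_deg_Bell_0]
    sum_choose_int_shift[of _ "deg_Bell lam" "deg_falling lam (lam - 1)"]
  by simp

end
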